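(* For an integer $N\ge 2$ put $x_j=-1+2j/N$, $j=1,\dots,N$, and let $\xi_1,\dots,\xi_N$ be independent random variables, each uniformly distributed on $[0,1]$ (the lengths of the teeth of the random comb). For integers $n_1,n_2$ with $1\le n_1\le N/2<n_2\le N$ let $\mathsf P_N\{\nu=(n_1,n_2)\}$ be the probability that the interval $J$ is supported by the teeth with numbers $n_1$ and $n_2$. Let $I_-=[-1,0]$ and $I_+=[0,1]$. Then the limit density $p:I_-\times I_+\to[0,\infty)$ of the distribution of the pair of support points $a=(a_1,a_2)$, that is, $$p(a)=\lim_{N\to\infty}\frac{N^2}{4}\,\mathsf P_N\{\nu=(n_1,n_2)\},$$ where $n_i=n_i(N)$ satisfy $1\le n_1\le N/2<n_2\le N$ and $-1+2n_i/N\to a_i$ for $i=1,2$, is $$p(a)=(a_2-a_1)\Big(\frac{4}{3(1+a_2)^3}+\frac{4}{3(1-a_1)^3}+\frac16\Big).$$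
   Context: Random comb: at each point $w_j=(x_j,0)$ of the horizontal interval $I=\{(x,z)\in\mathbb R^2: x\in[-1,1],\ z=0\}$ there stands a vertical segment ("tooth") with lower end $w_j$ and upper end $(x_j,\xi_j)$. A straight interval $J$ lies on the comb and projects vertically exactly onto $I$; with probability $1$ it is supported by two teeth, one on each side of the center. "$J$ is supported by the teeth $n_1$ and $n_2$" (with $1\le n_1\le N/2<n_2\le N$) means that $J$ passes through the upper ends of the teeth $n_1,n_2$ and all other teeth lie under $J$, i.e. $\xi_j\le \ell(x_j)$ for all $j=1,\dots,N$, where $\ell$ is the affine function with $\ell(x_{n_1})=\xi_{n_1}$, $\ell(x_{n_2})=\xi_{n_2}$. *)

theory Defs
  imports "HOL-Probability.Probability"
begin

text \<open>Teeth are numbered from 1 to N; a realisation of their lengths is a function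
  \<open>z\<close> on the numbers, of which only the values at \<open>{1..N}\<close> matter.\<close>

definition tooth_pos :: "nat \<Rightarrow> nat \<Rightarrow> real" where
  "tooth_pos N j = -1 + 2 * real j / real N"

definition line_through :: "real \<times> real \<Rightarrow> real \<times> real \<Rightarrow> real \<Rightarrow> real" where
  "line_through P Q x = snd P + (snd Q - snd P) / (fst Q - fst P) * (x - fst P)"

definition admissible :: "nat \<Rightarrow> nat \<Rightarrow> nat \<Rightarrow> bool" where
  "admissible N n1 n2 \<longleftrightarrow>
     1 \<le> n1 \<and> real n1 \<le> real N / 2 \<and> real N / 2 < real n2 \<and> n2 \<le> N"

definition supported_by :: "nat \<Rightarrow> (nat \<Rightarrow> real) \<Rightarrow> nat \<Rightarrow> nat \<Rightarrow> bool" where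
  "supported_by N z n1 n2 \<longleftrightarrow> admissible N n1 n2 \<and>
     (\<forall>j\<in>{1..N}.
        z j \<le> line_through (tooth_pos N n1, z n1) (tooth_pos N n2, z n2) (tooth_pos N j))"

definition random_comb :: "nat \<Rightarrow> 'a measure \<Rightarrow> (nat \<Rightarrow> 'a \<Rightarrow> real) \<Rightarrow> bool" where
  "random_comb N M \<xi> \<longleftrightarrow>
     prob_space M \<and>
     prob_space.indep_vars M (\<lambda>_. borel) \<xi> {1..N} \<and>
     (\<forall>j\<in>{1..N}. distr M borel (\<xi> j) = uniform_measure lborel {0..1})"

definition support_prob :: "nat \<Rightarrow> 'a measure \<Rightarrow> (nat \<Rightarrow> 'a \<Rightarrow> real) \<Rightarrow> nat \<Rightarrow> nat \<Rightarrow> real" where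
  "support_prob N M \<xi> n1 n2 =
     measure M {\<omega> \<in> space M. supported_by N (\<lambda>j. \<xi> j \<omega>) n1 n2}"

text \<open>The factor \<open>N\<^sup>2 / 4\<close> is the reciprocal of the area of a cell of the grid of
  pairs of tooth positions, whose spacing is \<open>2 / N\<close>. The limit has to exist along every
  choice of \<open>n1(N), n2(N)\<close> whose positions converge to \<open>a\<close>, the boundary points of the
  rectangle included. Values of \<open>p\<close> outside the rectangle are irrelevant.\<close>

definition limit_density ::
    "(nat \<Rightarrow> 'a measure) \<Rightarrow> (nat \<Rightarrow> nat \<Rightarrow> 'a \<Rightarrow> real) \<Rightarrow> (real \<times> real \<Rightarrow> real) \<Rightarrow> bool" where
  "limit_density M \<xi> p \<longleftrightarrow>
     (\<forall>a1\<in>{-1..0}. \<forall>a2\<in>{0..1}. 0 \<le> p (a1, a2) \<and>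
        (\<forall>n1 n2 :: nat \<Rightarrow> nat.
           (\<forall>N\<ge>2. admissible N (n1 N) (n2 N)) \<longrightarrow>
           (\<lambda>N. tooth_pos N (n1 N)) \<longlonglongrightarrow> a1 \<longrightarrow>
           (\<lambda>N. tooth_pos N (n2 N)) \<longlonglongrightarrow> a2 \<longrightarrow>
           (\<lambda>N. real N ^ 2 / 4 * support_prob N (M N) (\<xi> N) (n1 N) (n2 N))
             \<longlonglongrightarrow> p (a1, a2)))"

end

theory Submission
  imports Defs
begin

text \<open>Condition on the lengths \<open>u\<close>, \<open>v\<close> of the two supporting teeth. The other \<open>N - 2\<close> teeth must stay
below the line \<open>\<ell>\<close> through the two tips, which by independence has probability
\<open>\<Prod> F (\<ell> (x\<^sub>j))\<close>, where \<open>F\<close> is the distribution function of a single length. The probability of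
support is the integral of this product over \<open>(u, v)\<close> in the unit square
(\<open>emeasure_supported_by\<close>).

A product of about \<open>N\<close> such factors is of order one only if \<open>\<ell>\<close> falls below the height \<open>1\<close> by
no more than \<open>O(1/N)\<close>. So write \<open>\<ell> (x) = 1 - (2/N) (c + k x)\<close> and take the slope \<open>k\<close> and the intercept \<open>c\<close> as new
variables. The Jacobian is \<open>(2/N)\<^sup>2\<close> times the distance of the two teeth: the first factor
cancels the normalisation \<open>N\<^sup>2/4\<close>, the second one becomes the factor \<open>a\<^sub>2 - a\<^sub>1\<close> of the density
(\<open>emeasure_supported_by_eq\<close>). A tooth in a place where \<open>\<ell>\<close> exceeds \<open>1\<close> costs nothing, hence
the logarithm of the product is a Riemann sum for minus the integral of the positive part of
\<open>c + k x\<close> over \<open>[-1, 1]\<close>, and the integrand tends to the exponential of that, restricted to the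
\<open>(k, c)\<close> with \<open>c + k a\<^sub>1 \<ge> 0\<close> and \<open>c + k a\<^sub>2 \<ge> 0\<close>; these conditions remain from
\<open>u \<le> 1\<close> and \<open>v \<le> 1\<close> (\<open>scaled_density_tendsto\<close>).

For dominated convergence one uses that the two supporting teeth stand on different sides of
\<open>0\<close>: this forces \<open>c \<ge> 0\<close>, and on the side where \<open>k x \<ge> 0\<close> a fixed fraction of the teeth
contributes at least \<open>(2/N) (c + \<bar>k\<bar>/2)\<close> each to the exponent (\<open>scaled_density_le\<close>). As the
bound does not involve \<open>a\<^sub>1\<close>, \<open>a\<^sub>2\<close>, the boundary of the rectangle, including
\<open>a\<^sub>1 = a\<^sub>2 = 0\<close>, needs no separate treatment.

The limit integral splits into \<open>k > 0\<close>, where only the condition at \<open>a\<^sub>1\<close> matters, and \<open>k < 0\<close>,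
where only that at \<open>a\<^sub>2\<close> does. The substitution \<open>c = k z\<close> turns each half into an elementary
integral (\<open>nn_integral_hinge_wedge\<close>).\<close>

section \<open>Uniform tooth lengths\<close>

abbreviation unif01 :: "real measure" where
  "unif01 \<equiv> uniform_measure lborel {0..1}"

lemma prob_space_unif01: "prob_space unif01"
  by (rule prob_space_uniform_measure) auto

definition unif01_cdf :: "real \<Rightarrow> real" where
  "unif01_cdf t = max 0 (min 1 t)"

lemma unif01_cdf_bounds: "0 \<le> unif01_cdf t" "unif01_cdf t \<le> 1"
  by (auto simp: unif01_cdf_def)

lemma borel_measurable_unif01_cdf [measurable]: "unif01_cdf \<in> borel_measurable borel"
  unfolding unif01_cdf_def by measurable

lemma emeasure_unif01_atMost: "emeasure unif01 {..t} = ennreal (unif01_cdf t)"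
proof -
  have "{0..1} \<inter> {..t} = {0..min 1 t}" by auto
  then show ?thesis by (auto simp: unif01_cdf_def max_def divide_ennreal_def)
qed

lemma nn_integral_unif01:
  assumes [measurable]: "f \<in> borel_measurable borel"
  shows "(\<integral>\<^sup>+x. f x \<partial>unif01) = (\<integral>\<^sup>+x. f x * indicator {0..1} x \<partial>lborel)"
  by (subst nn_integral_uniform_measure) (auto simp: divide_ennreal_def)

text \<open>The upper half of the comparison of \<open>ln (1 - y)\<close> with \<open>- y\<close>. With the positive part in the
exponent it holds for every real \<open>y\<close>: the distribution function is \<open>1\<close> for \<open>y \<le> 0\<close> and \<open>0\<close> for
\<open>y \<ge> 1\<close>.\<close>

lemma unif01_cdf_le_exp: "unif01_cdf (1 - y) \<le> exp (- max 0 y)"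
  using exp_ge_add_one_self[of "- max 0 y"] by (auto simp: unif01_cdf_def max_def min_def)

lemma unif01_cdf_ge_exp:
  assumes "y \<le> 1 / 2"
  shows "exp (- max 0 y - 2 * (max 0 y)\<^sup>2) \<le> unif01_cdf (1 - y)"
proof -
  let ?h = "max 0 y"
  have h: "0 \<le> ?h" "?h \<le> 1 / 2" and eq: "unif01_cdf (1 - y) = 1 - ?h"
    using assms by (auto simp: unif01_cdf_def)
  have "exp (- ?h - 2 * ?h\<^sup>2) \<le> exp (ln (1 - ?h))"
    using ln_one_minus_pos_lower_bound[OF h] by simp
  then show ?thesis
    using h by (simp add: eq)
qed

section \<open>Tooth positions and lines\<close>

lemma tooth_pos_0 [simp]: "tooth_pos N 0 = -1"
  and tooth_pos_self [simp]: "0 < N \<Longrightarrow> tooth_pos N N = 1"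
  and tooth_pos_Suc: "tooth_pos N (Suc j) = tooth_pos N j + 2 / real N"
  by (simp_all add: tooth_pos_def add_divide_distrib)

lemma tooth_pos_less: "0 < N \<Longrightarrow> i < j \<Longrightarrow> tooth_pos N i < tooth_pos N j"
  by (simp add: tooth_pos_def divide_strict_right_mono)

lemma abs_tooth_pos_le: "j \<in> {1..N} \<Longrightarrow> \<bar>tooth_pos N j\<bar> \<le> 1"
  by (auto simp: tooth_pos_def abs_le_iff field_simps)

lemma admissible_less:
  assumes "admissible N n1 n2"
  shows "n1 < n2" "n1 \<in> {1..N}" "n2 \<in> {1..N}" "0 < N"
proof -
  have "real n1 < real n2" using assms by (auto simp: admissible_def)
  then show "n1 < n2" by simp
  then show "n1 \<in> {1..N}" "n2 \<in> {1..N}" "0 < N" using assms by (auto simp: admissible_def)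
qed

lemma line_through_left [simp]: "line_through (a, u) (b, v) a = u"
  by (simp add: line_through_def)

lemma line_through_right [simp]: "a \<noteq> b \<Longrightarrow> line_through (a, u) (b, v) b = v"
  by (simp add: line_through_def)

lemma line_through_affine:
  assumes "a \<noteq> b"
  shows "line_through (a, 1 - e * (c + k * a)) (b, 1 - e * (c + k * b)) x = 1 - e * (c + k * x)"
proof -
  have "(1 - e * (c + k * b) - (1 - e * (c + k * a))) / (b - a) = - (e * k)"
    using assms by (simp add: field_simps)
  then show ?thesis
    by (simp add: line_through_def algebra_simps)
qed

section \<open>The support probability as an integral over lines\<close>

text \<open>Independence and uniformity say that the vector of lengths is distributed like the coordinates of
the \<open>N\<close>-fold product of the uniform distribution. The points of that product are functions
restricted to \<open>{1..N}\<close>, hence the condition that the event depends on the values there only.\<close>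

lemma emeasure_random_comb:
  assumes comb: "random_comb N M \<xi>" and "0 < N"
    and P: "Measurable.pred (\<Pi>\<^sub>M j\<in>{1..N}. unif01) P"
    and cong: "\<And>z. P (restrict z {1..N}) = P z"
  shows "emeasure M {\<omega>\<in>space M. P (\<lambda>j. \<xi> j \<omega>)} =
    (\<integral>\<^sup>+z. indicator {z. P z} z \<partial>(\<Pi>\<^sub>M j\<in>{1..N}. unif01))"
proof -
  interpret prob_space M using comb by (simp add: random_comb_def)
  have indep: "indep_vars (\<lambda>_. borel) \<xi> {1..N}"
    and law: "\<And>j. j \<in> {1..N} \<Longrightarrow> distr M borel (\<xi> j) = unif01"
    using comb by (auto simp: random_comb_def)
  have rv [measurable]: "random_variable borel (\<xi> j)" if "j \<in> {1..N}" for j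
    using indep that by (auto simp: indep_vars_def)
  let ?X = "\<lambda>\<omega>. \<lambda>j\<in>{1..N}. \<xi> j \<omega>"
  have X [measurable]: "?X \<in> measurable M (\<Pi>\<^sub>M j\<in>{1..N}. borel)"
    by (rule measurable_restrict) (rule rv)
  have "distr M (\<Pi>\<^sub>M j\<in>{1..N}. borel) ?X = (\<Pi>\<^sub>M j\<in>{1..N}. distr M borel (\<xi> j))"
    using indep \<open>0 < N\<close> by (subst (asm) indep_vars_iff_distr_eq_PiM') (auto intro: rv)
  also have "\<dots> = (\<Pi>\<^sub>M j\<in>{1..N}. unif01)"
    by (intro PiM_cong refl law)
  finally have D: "distr M (\<Pi>\<^sub>M j\<in>{1..N}. borel) ?X = (\<Pi>\<^sub>M j\<in>{1..N}. unif01)" .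
  have S: "{z\<in>space (\<Pi>\<^sub>M j\<in>{1..N}. unif01). P z} \<in> sets (\<Pi>\<^sub>M j\<in>{1..N}. unif01)" (is "?S \<in> _")
    using P by measurable
  have sets_eq: "sets (\<Pi>\<^sub>M j\<in>{1..N}. unif01) = sets (\<Pi>\<^sub>M j\<in>{1..N}. (borel :: real measure))"
    by (intro sets_PiM_cong) auto
  have "{\<omega>\<in>space M. P (\<lambda>j. \<xi> j \<omega>)} = ?X -` ?S \<inter> space M"
    using cong by (auto simp: space_PiM cong[of "\<lambda>j. \<xi> j _", simplified])
  then have "emeasure M {\<omega>\<in>space M. P (\<lambda>j. \<xi> j \<omega>)} = emeasure (distr M (\<Pi>\<^sub>M j\<in>{1..N}. borel) ?X) ?S"
    using S X by (subst emeasure_distr) (auto simp only: sets_eq)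
  also have "\<dots> = (\<integral>\<^sup>+z. indicator ?S z \<partial>(\<Pi>\<^sub>M j\<in>{1..N}. unif01))"
    unfolding D using S by (rule nn_integral_indicator[symmetric])
  also have "\<dots> = (\<integral>\<^sup>+z. indicator {z. P z} z \<partial>(\<Pi>\<^sub>M j\<in>{1..N}. unif01))"
    by (intro nn_integral_cong) (auto simp: indicator_def)
  finally show ?thesis .
qed

text \<open>Fubini separates the coordinates \<open>n1\<close> and \<open>n2\<close> from the rest. For fixed lengths \<open>u\<close> and \<open>v\<close> of
these two teeth the event is a box in the remaining coordinates, and its measure factorises.\<close>

lemma emeasure_supported_by:
  fixes N n1 n2 :: nat
  assumes comb: "random_comb N M \<xi>" and adm: "admissible N n1 n2"
  defines "line u v \<equiv> line_through (tooth_pos N n1, u) (tooth_pos N n2, v)"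
  shows "emeasure M {\<omega>\<in>space M. supported_by N (\<lambda>j. \<xi> j \<omega>) n1 n2} =
    (\<integral>\<^sup>+u. (\<integral>\<^sup>+v. ennreal (\<Prod>j\<in>{1..N} - {n1, n2}. unif01_cdf (line u v (tooth_pos N j)))
       * indicator {0..1} v \<partial>lborel) * indicator {0..1} u \<partial>lborel)"
proof -
  let ?x = "tooth_pos N"
  let ?P = "\<lambda>z. supported_by N z n1 n2"
  note n = admissible_less[OF adm]
  have x12: "?x n1 < ?x n2" using tooth_pos_less n by blast
  interpret product_sigma_finite "\<lambda>_::nat. unif01"
    by (simp add: product_sigma_finite_def prob_space_imp_sigma_finite prob_space_unif01)
  define R where "R = {1..N} - {n1, n2}"
  have I: "{1..N} = insert n1 (insert n2 R)" and [simp]: "finite R" "n1 \<notin> R" "n2 \<notin> R"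
    using n by (auto simp: R_def)
  have pred_P: "Measurable.pred (\<Pi>\<^sub>M j\<in>{1..N}. unif01) ?P"
  proof -
    let ?B = "\<Pi>\<^sub>M j\<in>{1..N}. (borel :: real measure)"
    have comp: "(\<lambda>z. z j) \<in> borel_measurable ?B" if "j \<in> {1..N}" for j
      by (rule measurable_component_singleton[OF that])
    have line: "Measurable.pred ?B (\<lambda>z. z j \<le> line_through (?x n1, z n1) (?x n2, z n2) (?x j))"
      if "j \<in> {1..N}" for j
      unfolding line_through_def fst_conv snd_conv pred_def
      by (intro borel_measurable_le borel_measurable_add borel_measurable_times borel_measurable_diff
            borel_measurable_divide borel_measurable_const comp n that)
    have "Measurable.pred ?B ?P"
      unfolding supported_by_def
      by (intro pred_intros_logic pred_intros_finite line) auto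
    moreover have "sets (\<Pi>\<^sub>M j\<in>{1..N}. unif01) = sets ?B"
      by (intro sets_PiM_cong) auto
    ultimately show ?thesis
      by (simp cong: measurable_cong_sets)
  qed
  then have ind_P: "(\<lambda>z. indicator {z. ?P z} z :: ennreal) \<in> borel_measurable (\<Pi>\<^sub>M j\<in>{1..N}. unif01)"
    by (intro borel_measurable_indicator') (simp add: pred_def)
  have "emeasure M {\<omega>\<in>space M. ?P (\<lambda>j. \<xi> j \<omega>)} =
      (\<integral>\<^sup>+z. indicator {z. ?P z} z \<partial>(\<Pi>\<^sub>M j\<in>{1..N}. unif01))"
    using n pred_P by (intro emeasure_random_comb comb) (auto simp: supported_by_def)
  also have "\<dots> = (\<integral>\<^sup>+u. (\<integral>\<^sup>+z. indicator {z. ?P z} (z(n1 := u)) \<partial>(\<Pi>\<^sub>M j\<in>insert n2 R. unif01)) \<partial>unif01)"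
    using n ind_P unfolding I by (intro product_nn_integral_insert_rev) auto
  also have "\<dots> = (\<integral>\<^sup>+u. (\<integral>\<^sup>+v. (\<integral>\<^sup>+z. indicator {z. ?P z} (z(n2 := v, n1 := u)) \<partial>(\<Pi>\<^sub>M j\<in>R. unif01)) \<partial>unif01) \<partial>unif01)"
  proof (intro nn_integral_cong product_nn_integral_insert_rev)
    fix u
    have "(\<lambda>z. z(n1 := u)) \<in> measurable (\<Pi>\<^sub>M j\<in>insert n2 R. unif01) (\<Pi>\<^sub>M j\<in>insert n1 (insert n2 R). unif01)"
      by (rule measurable_fun_upd[where J = "insert n2 R"]) auto
    then show "(\<lambda>z. indicator {z. ?P z} (z(n1 := u)) :: ennreal) \<in> borel_measurable (\<Pi>\<^sub>M j\<in>insert n2 R. unif01)"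
      by (rule measurable_compose) (use ind_P in \<open>simp only: I[symmetric]\<close>)
  qed auto
  also have "\<dots> = (\<integral>\<^sup>+u. (\<integral>\<^sup>+v. ennreal (\<Prod>j\<in>R. unif01_cdf (line u v (?x j))) \<partial>unif01) \<partial>unif01)"
  proof (intro nn_integral_cong)
    fix u v :: real
    let ?B = "Pi\<^sub>E R (\<lambda>j. {..line u v (?x j)})"
    have *: "?P (z(n2 := v, n1 := u)) \<longleftrightarrow> (\<forall>j\<in>R. z j \<le> line u v (?x j))" for z
      using n x12 adm by (auto simp: supported_by_def line_def R_def)
    have "(\<integral>\<^sup>+z. indicator {z. ?P z} (z(n2 := v, n1 := u)) \<partial>(\<Pi>\<^sub>M j\<in>R. unif01)) =
        (\<integral>\<^sup>+z. indicator ?B z \<partial>(\<Pi>\<^sub>M j\<in>R. unif01))"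
      by (intro nn_integral_cong) (auto simp: * indicator_def space_PiM PiE_iff)
    also have "\<dots> = emeasure (\<Pi>\<^sub>M j\<in>R. unif01) ?B"
      by (intro nn_integral_indicator sets_PiM_I_finite) auto
    also have "\<dots> = (\<Prod>j\<in>R. ennreal (unif01_cdf (line u v (?x j))))"
      by (subst emeasure_PiM) (auto simp: emeasure_unif01_atMost)
    also have "\<dots> = ennreal (\<Prod>j\<in>R. unif01_cdf (line u v (?x j)))"
      by (intro prod_ennreal) (auto simp: unif01_cdf_bounds)
    finally show "(\<integral>\<^sup>+z. indicator {z. ?P z} (z(n2 := v, n1 := u)) \<partial>(\<Pi>\<^sub>M j\<in>R. unif01)) = \<dots>" .
  qed
  also have "\<dots> = (\<integral>\<^sup>+u. (\<integral>\<^sup>+v. ennreal (\<Prod>j\<in>R. unif01_cdf (line u v (?x j))) * indicator {0..1} v \<partial>lborel) * indicator {0..1} u \<partial>lborel)"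
    unfolding line_def line_through_def fst_conv snd_conv
    by (simp add: nn_integral_unif01)
  finally show ?thesis by (simp only: R_def)
qed

text \<open>A line is given by its heights at \<open>a\<close> and \<open>b\<close> or by its intercept and slope; this is the change
of variables between the two. Two one-dimensional affine substitutions suffice, first for the
slope with the height at \<open>a\<close> held fixed, then for the intercept with the slope held fixed.\<close>

lemma nn_integral_affine_coefficients:
  fixes g :: "real \<Rightarrow> real \<Rightarrow> ennreal"
  assumes g: "case_prod g \<in> borel_measurable (borel \<Otimes>\<^sub>M borel)" and "a < b" "0 < e"
  shows "(\<integral>\<^sup>+u. \<integral>\<^sup>+v. g u v \<partial>lborel \<partial>lborel) =
    ennreal (e\<^sup>2 * (b - a)) *
      (\<integral>\<^sup>+k. \<integral>\<^sup>+c. g (1 - e * (c + k * a)) (1 - e * (c + k * b)) \<partial>lborel \<partial>lborel)"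
proof -
  have [measurable]: "(\<lambda>x. g (p x) (q x)) \<in> borel_measurable N"
    if "p \<in> borel_measurable N" "q \<in> borel_measurable N" for p q and N :: "'b measure"
    using measurable_compose[OF measurable_Pair[OF that] g] by simp
  have "(\<integral>\<^sup>+u. \<integral>\<^sup>+v. g u v \<partial>lborel \<partial>lborel) =
      (\<integral>\<^sup>+u. ennreal (e * (b - a)) * (\<integral>\<^sup>+k. g u (u + - (e * (b - a)) * k) \<partial>lborel) \<partial>lborel)"
  proof (intro nn_integral_cong)
    fix u
    show "(\<integral>\<^sup>+v. g u v \<partial>lborel) = ennreal (e * (b - a)) * (\<integral>\<^sup>+k. g u (u + - (e * (b - a)) * k) \<partial>lborel)"
      using assms(2,3) by (subst nn_integral_real_affine[where c = "- (e * (b - a))" and t = u]) auto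
  qed
  also have "\<dots> = ennreal (e * (b - a)) * (\<integral>\<^sup>+u. \<integral>\<^sup>+k. g u (u + - (e * (b - a)) * k) \<partial>lborel \<partial>lborel)"
    by (intro nn_integral_cmult) measurable
  also have "(\<integral>\<^sup>+u. \<integral>\<^sup>+k. g u (u + - (e * (b - a)) * k) \<partial>lborel \<partial>lborel) =
      (\<integral>\<^sup>+k. \<integral>\<^sup>+u. g u (u + - (e * (b - a)) * k) \<partial>lborel \<partial>lborel)"
    by (intro lborel_pair.Fubini') measurable
  also have "\<dots> = (\<integral>\<^sup>+k. ennreal e *
      (\<integral>\<^sup>+c. g (1 - e * (c + k * a)) (1 - e * (c + k * b)) \<partial>lborel) \<partial>lborel)"
  proof (intro nn_integral_cong)
    fix k
    show "(\<integral>\<^sup>+u. g u (u + - (e * (b - a)) * k) \<partial>lborel) =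
        ennreal e * (\<integral>\<^sup>+c. g (1 - e * (c + k * a)) (1 - e * (c + k * b)) \<partial>lborel)"
      using assms(3)
      by (subst nn_integral_real_affine[where c = "- e" and t = "1 - e * k * a"])
         (auto simp: algebra_simps)
  qed
  also have "\<dots> = ennreal e * (\<integral>\<^sup>+k. \<integral>\<^sup>+c. g (1 - e * (c + k * a)) (1 - e * (c + k * b)) \<partial>lborel \<partial>lborel)"
    by (intro nn_integral_cmult) measurable
  finally have "(\<integral>\<^sup>+u. \<integral>\<^sup>+v. g u v \<partial>lborel \<partial>lborel) = ennreal (e * (b - a)) * (ennreal e *
      (\<integral>\<^sup>+k. \<integral>\<^sup>+c. g (1 - e * (c + k * a)) (1 - e * (c + k * b)) \<partial>lborel \<partial>lborel))" .
  moreover have "ennreal (e * (b - a)) * ennreal e = ennreal (e\<^sup>2 * (b - a))"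
    using assms(2,3) by (subst ennreal_mult'[symmetric]) (auto simp: power2_eq_square mult_ac)
  ultimately show ?thesis by (simp only: mult.assoc[symmetric])
qed

text \<open>The integrand of the support probability in the variables slope \<open>k\<close> and intercept \<open>c\<close> of the line
\<open>1 - (2/N) (c + k x)\<close>. The second product says that the tips of the two supporting teeth, which lie
on the line, have heights in the unit interval.\<close>

definition scaled_density :: "nat \<Rightarrow> nat \<Rightarrow> nat \<Rightarrow> real \<Rightarrow> real \<Rightarrow> real" where
  "scaled_density N n1 n2 k c =
     (\<Prod>j\<in>{1..N} - {n1, n2}. unif01_cdf (1 - 2 / real N * (c + k * tooth_pos N j))) *
     (\<Prod>j\<in>{n1, n2}. indicator {0..1} (1 - 2 / real N * (c + k * tooth_pos N j)))"

lemma borel_measurable_scaled_density [measurable]: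
  "(\<lambda>x. scaled_density N n1 n2 (f x) (g x)) \<in> borel_measurable M"
  if [measurable]: "f \<in> borel_measurable M" "g \<in> borel_measurable M"
  unfolding scaled_density_def by measurable

lemma emeasure_supported_by_eq:
  assumes comb: "random_comb N M \<xi>" and adm: "admissible N n1 n2"
  shows "emeasure M {\<omega>\<in>space M. supported_by N (\<lambda>j. \<xi> j \<omega>) n1 n2} =
    ennreal ((2 / real N)\<^sup>2 * (tooth_pos N n2 - tooth_pos N n1)) *
      (\<integral>\<^sup>+k. \<integral>\<^sup>+c. ennreal (scaled_density N n1 n2 k c) \<partial>lborel \<partial>lborel)"
proof -
  let ?x = "tooth_pos N"
  note n = admissible_less[OF adm]
  have x12: "?x n1 < ?x n2" using tooth_pos_less n by blast
  define g where "g u v = ennreal (\<Prod>j\<in>{1..N} - {n1, n2}. unif01_cdf (line_through (?x n1, u) (?x n2, v) (?x j)))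
       * indicator {0..1} v * indicator {0..1} u" for u v :: real
  have [measurable]: "(\<lambda>x. line_through (?x n1, p x) (?x n2, q x) t) \<in> borel_measurable K"
    if [measurable]: "p \<in> borel_measurable K" "q \<in> borel_measurable K" for p q t and K :: "(real \<times> real) measure"
    unfolding line_through_def fst_conv snd_conv by measurable
  have g: "case_prod g \<in> borel_measurable (borel \<Otimes>\<^sub>M borel)"
    unfolding g_def by measurable
  then have [measurable]: "g u \<in> borel_measurable borel" for u
    by simp
  have "emeasure M {\<omega>\<in>space M. supported_by N (\<lambda>j. \<xi> j \<omega>) n1 n2} = (\<integral>\<^sup>+u. \<integral>\<^sup>+v. g u v \<partial>lborel \<partial>lborel)"
    unfolding emeasure_supported_by[OF comb adm] g_def
    by (intro nn_integral_cong nn_integral_multc[symmetric]) (simp add: line_through_def)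
  also have "\<dots> = ennreal ((2 / real N)\<^sup>2 * (?x n2 - ?x n1)) * (\<integral>\<^sup>+k. \<integral>\<^sup>+c.
      g (1 - 2 / real N * (c + k * ?x n1)) (1 - 2 / real N * (c + k * ?x n2)) \<partial>lborel \<partial>lborel)"
    using n x12 by (intro nn_integral_affine_coefficients g) auto
  also have "(\<lambda>k c. g (1 - 2 / real N * (c + k * ?x n1)) (1 - 2 / real N * (c + k * ?x n2))) =
      (\<lambda>k c. ennreal (scaled_density N n1 n2 k c))"
  proof (intro ext)
    fix k c
    have split: "ennreal p * indicator {0..1} v * indicator {0..1} u = ennreal (p * (indicator {0..1} u * indicator {0..1} v))"
      for p u v :: real
      by (simp split: split_indicator)
    have prod2: "(\<Prod>j\<in>{n1, n2}. f j) = f n1 * f n2" for f :: "nat \<Rightarrow> real"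
      using n by simp
    show "g (1 - 2 / real N * (c + k * ?x n1)) (1 - 2 / real N * (c + k * ?x n2)) = ennreal (scaled_density N n1 n2 k c)"
      unfolding g_def scaled_density_def split prod2 line_through_affine[OF less_imp_neq[OF x12]] ..
  qed
  finally show ?thesis .
qed

section \<open>An integrable bound for all large combs\<close>

text \<open>On the side of \<open>0\<close> where \<open>k x \<ge> 0\<close>, the teeth with \<open>\<bar>x\<bar> \<ge> 1/2\<close> satisfy the inequality. They
number at least \<open>N div 4\<close>; at most two are removed, and for \<open>N \<ge> 24\<close> at least \<open>N/8\<close> remain.\<close>

lemma card_outer_quarter:
  fixes k :: real
  assumes "24 \<le> N"
  shows "real N / 8 \<le> card {j \<in> {1..N} - {n1, n2}. \<bar>k\<bar> / 2 \<le> k * tooth_pos N j}"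
    (is "_ \<le> real (card ?A)")
proof -
  define q where "q = N div 4"
  define B where "B = (if 0 \<le> k then {N - q + 1..N} else {1..q})"
  have q: "4 * q \<le> N" "N \<le> 4 * q + 3" unfolding q_def by linarith+
  have "B - {n1, n2} \<subseteq> ?A"
  proof
    fix j assume j: "j \<in> B - {n1, n2}"
    show "j \<in> ?A"
    proof (cases "0 \<le> k")
      case True
      then have "N + 1 \<le> j + q" "j \<le> N" using j q by (auto simp: B_def)
      then have "3 * real N \<le> 4 * real j" using q by linarith
      then have "1 / 2 \<le> tooth_pos N j" using assms by (simp add: tooth_pos_def field_simps)
      then have "k * (1 / 2) \<le> k * tooth_pos N j" using True by (rule mult_left_mono)
      then show ?thesis using True j q \<open>N + 1 \<le> j + q\<close> \<open>j \<le> N\<close> assms by auto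
    next
      case False
      then have "1 \<le> j" "j \<le> q" using j by (auto simp: B_def)
      then have "4 * real j \<le> real N" using q by linarith
      then have "tooth_pos N j \<le> - (1 / 2)" using assms by (simp add: tooth_pos_def field_simps)
      then have "k * (- (1 / 2)) \<le> k * tooth_pos N j" using False by (intro mult_left_mono_neg) auto
      then show ?thesis using False j q \<open>1 \<le> j\<close> \<open>j \<le> q\<close> by auto
    qed
  qed
  then have "card (B - {n1, n2}) \<le> card ?A" by (intro card_mono) auto
  moreover have "card B = q" using q by (auto simp: B_def)
  moreover have "card B - card {n1, n2} \<le> card (B - {n1, n2})" by (rule diff_card_le_card_Diff) auto
  moreover have "card {n1, n2} \<le> 2" by (simp add: card_insert_if)
  ultimately have "q \<le> card ?A + 2" by linarith
  then show ?thesis using q assms by linarith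
qed

text \<open>The bound must not deteriorate when the supporting teeth approach each other near \<open>0\<close>. There the
slope may be as large as \<open>N\<^sup>2/4\<close>, but the line \<open>c + k x\<close> is nonnegative on both sides of \<open>0\<close>, so \<open>c \<ge> 0\<close>;
and the teeth of \<open>card_outer_quarter\<close> give a factor of at most \<open>exp (- (2/N) (c + \<bar>k\<bar>/2))\<close> each.\<close>

lemma scaled_density_le:
  assumes adm: "admissible N n1 n2" and N: "24 \<le> N"
  shows "scaled_density N n1 n2 k c \<le> indicator {0..} c * exp (- (c + \<bar>k\<bar> / 2) / 4)"
proof (cases "scaled_density N n1 n2 k c = 0")
  case False
  let ?x = "tooth_pos N"
  let ?R = "{1..N} - {n1, n2}"
  let ?f = "\<lambda>j. unif01_cdf (1 - 2 / real N * (c + k * ?x j))"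
  let ?A = "{j \<in> ?R. \<bar>k\<bar> / 2 \<le> k * ?x j}"
  let ?y = "2 / real N * (c + \<bar>k\<bar> / 2)"
  note n = admissible_less[OF adm]
  have pos: "0 < real N" using n by simp
  have *: "1 - 2 / real N * (c + k * ?x j) \<in> {0..1}" if "j \<in> {n1, n2}" for j
    using False that n by (auto simp: scaled_density_def indicator_def split: if_splits)
  have h: "0 \<le> c + k * ?x j" if "j \<in> {n1, n2}" for j
  proof -
    have "0 \<le> 2 / real N * (c + k * ?x j)" using *[OF that] by simp
    then show ?thesis using pos by (simp add: zero_le_mult_iff zero_le_divide_iff)
  qed
  have x: "?x n1 \<le> 0" "0 < ?x n2"
    using adm pos by (auto simp: admissible_def tooth_pos_def field_simps)
  have c: "0 \<le> c"
  proof (cases "0 \<le> k")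
    case True
    then have "k * ?x n1 \<le> 0" using x by (simp add: mult_nonneg_nonpos)
    then show ?thesis using h[of n1] by simp
  next
    case False
    then have "k * ?x n2 \<le> 0" using x by (simp add: mult_nonpos_nonneg)
    then show ?thesis using h[of n2] by simp
  qed
  have y: "0 \<le> ?y" using c by simp
  have "scaled_density N n1 n2 k c \<le> (\<Prod>j\<in>?R. ?f j) * 1"
    unfolding scaled_density_def
    by (intro mult_left_mono prod_le_1 prod_nonneg) (auto simp: unif01_cdf_bounds indicator_def)
  also have "(\<Prod>j\<in>?R. ?f j) * 1 = (\<Prod>j\<in>?A. ?f j) * (\<Prod>j\<in>?R - ?A. ?f j)"
    by (subst prod.subset_diff[of ?A ?R]) (auto simp: mult.commute)
  also have "\<dots> \<le> (\<Prod>j\<in>?A. ?f j) * 1"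
    by (intro mult_left_mono prod_le_1 prod_nonneg) (auto simp: unif01_cdf_bounds)
  also have "(\<Prod>j\<in>?A. ?f j) \<le> (\<Prod>j\<in>?A. exp (- ?y))"
  proof (intro prod_mono conjI)
    fix j assume "j \<in> ?A"
    then have "?y \<le> 2 / real N * (c + k * ?x j)"
      using pos by (intro mult_left_mono) auto
    then have "?y \<le> max 0 (2 / real N * (c + k * ?x j))"
      by (rule max.coboundedI2)
    then have "exp (- max 0 (2 / real N * (c + k * ?x j))) \<le> exp (- ?y)"
      by (simp only: exp_le_cancel_iff neg_le_iff_le)
    then show "?f j \<le> exp (- ?y)"
      by (rule order_trans[OF unif01_cdf_le_exp])
  qed (simp add: unif01_cdf_bounds)
  also have "(\<Prod>j\<in>?A. exp (- ?y)) = exp (- (real (card ?A) * ?y))"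
    by (simp add: exp_of_nat_mult[symmetric])
  also have "\<dots> \<le> exp (- (real N / 8 * ?y))"
    using mult_right_mono[OF card_outer_quarter[OF N, of n1 n2 k] y] by simp
  also have "\<dots> = exp (- (c + \<bar>k\<bar> / 2) / 4)"
    using pos by (simp add: field_simps)
  finally show ?thesis using c by simp
qed auto

lemma nn_integral_power_exp:
  fixes l :: real
  assumes "0 < l"
  shows "(\<integral>\<^sup>+x. ennreal (x ^ n * exp (- (l * x))) * indicator {0..} x \<partial>lborel) = ennreal (fact n / l ^ Suc n)"
proof -
  have "ennreal (fact n) = (\<integral>\<^sup>+x. ennreal (x ^ n * exp (- x)) * indicator {0..} x \<partial>lborel)"
    by (simp add: nn_intergal_power_times_exp_Ici)
  also have "\<dots> = ennreal l * (\<integral>\<^sup>+x. ennreal ((l * x) ^ n * exp (- (l * x))) * indicator {0..} (l * x) \<partial>lborel)"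
    using assms by (subst nn_integral_real_affine[where c = l and t = 0]) auto
  also have "(\<lambda>x. ennreal ((l * x) ^ n * exp (- (l * x))) * indicator {0..} (l * x)) =
      (\<lambda>x. ennreal (l ^ n) * (ennreal (x ^ n * exp (- (l * x))) * indicator {0..} x))"
    using assms by (auto simp: fun_eq_iff indicator_def zero_le_mult_iff power_mult_distrib ennreal_mult'[symmetric] mult.assoc)
  also have "ennreal l * (\<integral>\<^sup>+x. ennreal (l ^ n) * (ennreal (x ^ n * exp (- (l * x))) * indicator {0..} x) \<partial>lborel) =
      ennreal (l ^ Suc n) * (\<integral>\<^sup>+x. ennreal (x ^ n * exp (- (l * x))) * indicator {0..} x \<partial>lborel)"
    using assms by (subst nn_integral_cmult) (auto simp: ennreal_mult' mult.assoc)
  finally have fact_eq: "ennreal (fact n) = ennreal (l ^ Suc n) *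
      (\<integral>\<^sup>+x. ennreal (x ^ n * exp (- (l * x))) * indicator {0..} x \<partial>lborel)" .
  have "ennreal (fact n / l ^ Suc n) = ennreal (1 / l ^ Suc n) * ennreal (fact n)"
    using assms by (subst ennreal_mult'[symmetric]) auto
  also note fact_eq
  also have "ennreal (1 / l ^ Suc n) * (ennreal (l ^ Suc n) *
      (\<integral>\<^sup>+x. ennreal (x ^ n * exp (- (l * x))) * indicator {0..} x \<partial>lborel)) =
      (ennreal (1 / l ^ Suc n) * ennreal (l ^ Suc n)) *
      (\<integral>\<^sup>+x. ennreal (x ^ n * exp (- (l * x))) * indicator {0..} x \<partial>lborel)"
    by (simp only: mult.assoc)
  also have "\<dots> = (\<integral>\<^sup>+x. ennreal (x ^ n * exp (- (l * x))) * indicator {0..} x \<partial>lborel)"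
    using assms by (subst ennreal_mult'[symmetric]) (auto simp del: power_Suc)
  finally show ?thesis ..
qed

lemma nn_integral_dominating_function:
  "(\<integral>\<^sup>+x. ennreal (indicator {0..} (snd x) * exp (- (snd x + \<bar>fst x\<bar> / 2) / 4)) \<partial>(lborel \<Otimes>\<^sub>M lborel :: (real \<times> real) measure)) < \<infinity>"
proof -
  have exp_int: "(\<integral>\<^sup>+x. ennreal (exp (- (l * x))) * indicator {0..} x \<partial>lborel) = ennreal (1 / l)" if "0 < l" for l :: real
    using nn_integral_power_exp[OF that, of 0] by simp
  have "(\<integral>\<^sup>+x. ennreal (indicator {0..} (snd x) * exp (- (snd x + \<bar>fst x\<bar> / 2) / 4)) \<partial>(lborel \<Otimes>\<^sub>M lborel :: (real \<times> real) measure)) =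
      (\<integral>\<^sup>+k. \<integral>\<^sup>+c. ennreal (exp (- (\<bar>k\<bar> / 8))) * (ennreal (exp (- (1 / 4 * c))) * indicator {0..} c) \<partial>lborel \<partial>lborel)"
    by (subst lborel.nn_integral_fst[symmetric])
       (auto intro!: nn_integral_cong simp: indicator_def ennreal_mult'[symmetric] exp_add[symmetric] field_simps)
  also have "\<dots> = (\<integral>\<^sup>+k. ennreal (exp (- (\<bar>k\<bar> / 8))) * 4 \<partial>lborel)"
    using exp_int[of "1 / 4"] by (subst nn_integral_cmult) auto
  also have "\<dots> = (\<integral>\<^sup>+k. ennreal (exp (- (\<bar>k\<bar> / 8))) \<partial>lborel) * 4"
    by (intro nn_integral_multc) auto
  also have "(\<integral>\<^sup>+k. ennreal (exp (- (\<bar>k\<bar> / 8))) \<partial>lborel) \<le>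
      (\<integral>\<^sup>+k. ennreal (exp (- (1 / 8 * k))) * indicator {0..} k + ennreal (exp (- (1 / 8 * (- k)))) * indicator {0..} (- k) \<partial>lborel)"
    by (intro nn_integral_mono) (auto simp: indicator_def abs_if)
  also have "\<dots> = (\<integral>\<^sup>+k. ennreal (exp (- (1 / 8 * k))) * indicator {0..} k \<partial>lborel) +
      (\<integral>\<^sup>+k. ennreal (exp (- (1 / 8 * (- k)))) * indicator {0..} (- k) \<partial>lborel)"
    by (intro nn_integral_add) auto
  also have "(\<integral>\<^sup>+k. ennreal (exp (- (1 / 8 * (- k)))) * indicator {0..} (- k) \<partial>lborel) =
      (\<integral>\<^sup>+k. ennreal (exp (- (1 / 8 * k))) * indicator {0..} k \<partial>lborel)"
    by (subst (2) nn_integral_real_affine[where c = "-1" and t = 0]) auto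
  also have "(\<integral>\<^sup>+k. ennreal (exp (- (1 / 8 * k))) * indicator {0..} k \<partial>lborel) = 8"
    by (subst exp_int) auto
  finally have "(\<integral>\<^sup>+x. ennreal (indicator {0..} (snd x) * exp (- (snd x + \<bar>fst x\<bar> / 2) / 4)) \<partial>(lborel \<Otimes>\<^sub>M lborel :: (real \<times> real) measure)) \<le> (8 + 8) * 4"
    by (simp add: mult_right_mono)
  also have "\<dots> < \<infinity>"
    by (simp add: ennreal_mult_less_top)
  finally show ?thesis .
qed

section \<open>Riemann sums over the teeth\<close>

text \<open>A cell of length \<open>2/N\<close> contributes an error of at most \<open>L (2/N)\<^sup>2\<close>, as the function deviates by at
most \<open>L (2/N)\<close> from its value at the right end. The partial sums make this an induction.\<close>

lemma riemann_sum_tooth_pos_error: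
  assumes lip: "\<And>x y. \<bar>g x - g y\<bar> \<le> L * \<bar>x - y\<bar>"
    and "continuous_on UNIV g" "0 < N" "0 \<le> (L :: real)"
  shows "\<bar>integral {-1..tooth_pos N m} g - 2 / real N * (\<Sum>j=1..m. g (tooth_pos N j))\<bar> \<le> real m * (L * (2 / real N)\<^sup>2)"
proof (induction m)
  case (Suc m)
  let ?x = "tooth_pos N" and ?e = "2 / real N"
  have cont: "continuous_on A g" for A
    using assms(2) continuous_on_subset by blast
  have e: "0 < ?e" using assms by simp
  have le: "-1 \<le> ?x m" "?x m \<le> ?x (Suc m)" using assms by (simp_all add: tooth_pos_def divide_right_mono)
  have "integral {-1..?x (Suc m)} g = integral {-1..?x m} g + integral {?x m..?x (Suc m)} g"
    using le by (intro Henstock_Kurzweil_Integration.integral_combine[symmetric] integrable_continuous_real cont)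
  moreover have "\<bar>integral {?x m..?x (Suc m)} g - ?e * g (?x (Suc m))\<bar> \<le> L * ?e\<^sup>2"
  proof -
    have "integral {?x m..?x (Suc m)} (\<lambda>t. g t - g (?x (Suc m))) =
        integral {?x m..?x (Suc m)} g - integral {?x m..?x (Suc m)} (\<lambda>t. g (?x (Suc m)))"
      by (intro Henstock_Kurzweil_Integration.integral_diff integrable_continuous_real cont continuous_intros)
    also have "\<dots> = integral {?x m..?x (Suc m)} g - ?e * g (?x (Suc m))"
      using le by (simp add: tooth_pos_Suc)
    finally have *: "integral {?x m..?x (Suc m)} (\<lambda>t. g t - g (?x (Suc m))) = \<dots>" .
    have "norm (integral {?x m..?x (Suc m)} (\<lambda>t. g t - g (?x (Suc m)))) \<le> (L * ?e) * (?x (Suc m) - ?x m)"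
    proof (rule integral_bound)
      fix t assume t: "t \<in> {?x m..?x (Suc m)}"
      have "\<bar>g t - g (?x (Suc m))\<bar> \<le> L * \<bar>t - ?x (Suc m)\<bar>" by (rule lip)
      also have "\<dots> \<le> L * ?e" using t assms(4) by (intro mult_left_mono) (auto simp: tooth_pos_Suc)
      finally show "norm (g t - g (?x (Suc m))) \<le> L * ?e" by simp
    qed (use le in \<open>auto intro!: continuous_intros cont\<close>)
    moreover have "?x (Suc m) - ?x m = ?e" by (simp add: tooth_pos_Suc)
    ultimately show ?thesis unfolding * by (simp only: power2_eq_square mult.assoc real_norm_def)
  qed
  ultimately show ?case
    using Suc.IH by (simp add: algebra_simps)
qed simp

lemma riemann_sum_tooth_pos:
  assumes lip: "\<And>x y. \<bar>g x - g y\<bar> \<le> L * \<bar>x - y\<bar>" and "0 \<le> L"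
  shows "(\<lambda>N. 2 / real N * (\<Sum>j=1..N. g (tooth_pos N j))) \<longlonglongrightarrow> integral {-1..1} g"
proof -
  have "L-lipschitz_on UNIV g"
    using assms by (auto simp: lipschitz_on_def dist_real_def)
  then have cont: "continuous_on UNIV g"
    by (rule lipschitz_on_continuous_on)
  have "(\<lambda>N. 2 / real N * (\<Sum>j=1..N. g (tooth_pos N j)) - integral {-1..1} g) \<longlonglongrightarrow> 0"
  proof (rule Lim_null_comparison)
    show "\<forall>\<^sub>F N in sequentially. norm (2 / real N * (\<Sum>j=1..N. g (tooth_pos N j)) - integral {-1..1} g) \<le> 4 * L / real N"
    proof (rule eventually_mono[OF eventually_gt_at_top[of 0]])
      fix N :: nat assume N: "0 < N"
      show "norm (2 / real N * (\<Sum>j=1..N. g (tooth_pos N j)) - integral {-1..1} g) \<le> 4 * L / real N"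
        using riemann_sum_tooth_pos_error[of g L N N] N assms cont
        by (simp add: power2_eq_square abs_minus_commute field_simps)
    qed
    show "(\<lambda>N. 4 * L / real N) \<longlonglongrightarrow> 0" by (rule lim_const_over_n)
  qed
  then show ?thesis by (simp add: LIM_zero_iff)
qed

section \<open>The limit of the integrand\<close>

text \<open>The area under the positive part of \<open>c + k x\<close> over \<open>[-1, 1]\<close>, for \<open>c \<ge> 0\<close> and \<open>k \<noteq> 0\<close>: a
right triangle of height \<open>c + \<bar>k\<bar>\<close> and slope \<open>\<bar>k\<bar>\<close>, less the part of it that lies beyond the
interval. The explicit formula makes measurability in \<open>(k, c)\<close> evident.\<close>

definition hinge_area :: "real \<Rightarrow> real \<Rightarrow> real" where
  "hinge_area k c = ((c + \<bar>k\<bar>)\<^sup>2 - (max 0 (c - \<bar>k\<bar>))\<^sup>2) / (2 * \<bar>k\<bar>)"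

lemma borel_measurable_hinge_area [measurable]:
  "(\<lambda>x. hinge_area (f x) (g x)) \<in> borel_measurable M"
  if [measurable]: "f \<in> borel_measurable M" "g \<in> borel_measurable M"
  unfolding hinge_area_def by measurable

lemma integral_hinge:
  assumes "k \<noteq> 0" "0 \<le> c"
  shows "integral {-1..1} (\<lambda>x. max 0 (c + k * x)) = hinge_area k c"
proof -
  define F where "F x = (max 0 (c + k * x))\<^sup>2 / (2 * k)" for x
  have "((\<lambda>x. max 0 (c + k * x)) has_integral (F 1 - F (-1))) {-1..1}"
  proof (rule fundamental_theorem_of_calculus_interior_strong[where S = "{- c / k}"])
    \<comment> \<open>The antiderivative \<open>F\<close> is locally a square or zero away from the kink at \<open>- c / k\<close>.\<close>
    fix x assume x: "x \<in> {- 1<..<1} - {- c / k}"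
    have "(F has_real_derivative max 0 (c + k * x)) (at x)"
    proof (cases "0 < c + k * x")
      case True
      have *: "((\<lambda>x. (c + k * x)\<^sup>2 / (2 * k)) has_real_derivative c + k * x) (at x)"
        using assms by (auto intro!: derivative_eq_intros simp: field_simps)
      have "\<forall>\<^sub>F t in nhds x. 0 < c + k * t"
        using True by (intro order_tendstoD(1)[where y = "c + k * x"] tendsto_intros) (auto simp: filterlim_ident)
      then have "\<forall>\<^sub>F t in nhds x. F t = (c + k * t)\<^sup>2 / (2 * k)"
        by eventually_elim (simp add: F_def)
      then show ?thesis
        using * True by (subst DERIV_cong_ev[OF refl _ refl]) auto
    next
      case False
      have "c + k * x \<noteq> 0" using x assms by (auto simp: field_simps)
      with False have neg: "c + k * x < 0" by simp
      have "\<forall>\<^sub>F t in nhds x. c + k * t < 0"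
        using neg by (intro order_tendstoD(2)[where y = "c + k * x"] tendsto_intros) (auto simp: filterlim_ident)
      then have "\<forall>\<^sub>F t in nhds x. F t = 0"
        by eventually_elim (simp add: F_def)
      then show ?thesis
        using neg by (subst DERIV_cong_ev[OF refl _ refl]) auto
    qed
    then show "(F has_vector_derivative max 0 (c + k * x)) (at x)"
      by (simp add: has_real_derivative_iff_has_vector_derivative)
  qed (use assms in \<open>auto simp: F_def[abs_def] intro!: continuous_intros\<close>)
  then have "integral {-1..1} (\<lambda>x. max 0 (c + k * x)) = F 1 - F (-1)"
    by (rule integral_unique)
  also have "\<dots> = hinge_area k c"
    using assms by (cases "0 < k") (auto simp: F_def hinge_area_def max_def abs_if diff_divide_distrib)
  finally show ?thesis .
qed

lemma abs_max_0_diff_le: "\<bar>max 0 a - max 0 b\<bar> \<le> \<bar>a - b\<bar>" for a b :: real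
  by (auto simp: max_def)

text \<open>The sum over all teeth differs from the sum over \<open>R\<close> by at most two terms of size \<open>B/N\<close>, and
replacing the factors by exponentials costs \<open>2\<close> times the sum of the squares, at most \<open>2 B\<^sup>2/N\<close>. Both
errors vanish in the limit.\<close>

lemma prod_unif01_cdf_bounds:
  assumes R: "R \<subseteq> {1..N}" "N \<le> card R + 2" and N: "4 * (\<bar>c\<bar> + \<bar>k\<bar>) \<le> real N" "0 < N"
  defines "B \<equiv> 2 * (\<bar>c\<bar> + \<bar>k\<bar>)" and "S \<equiv> 2 / real N * (\<Sum>j=1..N. max 0 (c + k * tooth_pos N j))"
  shows "exp (- S - 2 * B\<^sup>2 / real N) \<le> (\<Prod>j\<in>R. unif01_cdf (1 - 2 / real N * (c + k * tooth_pos N j)))"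
    and "(\<Prod>j\<in>R. unif01_cdf (1 - 2 / real N * (c + k * tooth_pos N j))) \<le> exp (- S + 2 * B / real N)"
proof -
  let ?y = "\<lambda>j. 2 / real N * (c + k * tooth_pos N j)"
  let ?h = "\<lambda>j. max 0 (?y j)"
  have fin: "finite R" using R finite_subset by blast
  have pos: "0 < real N" using N by simp
  have y: "\<bar>?y j\<bar> \<le> B / real N" if "j \<in> {1..N}" for j
  proof -
    have "\<bar>c + k * tooth_pos N j\<bar> \<le> \<bar>c\<bar> + \<bar>k\<bar> * 1"
      using mult_left_mono[OF abs_tooth_pos_le[OF that], of "\<bar>k\<bar>"]
      by (intro order_trans[OF abs_triangle_ineq]) (simp add: abs_mult)
    then have "2 / real N * \<bar>c + k * tooth_pos N j\<bar> \<le> 2 / real N * (\<bar>c\<bar> + \<bar>k\<bar>)"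
      by (intro mult_left_mono) auto
    moreover have "\<bar>?y j\<bar> = 2 / real N * \<bar>c + k * tooth_pos N j\<bar>"
      using pos by (simp only: abs_mult) simp
    ultimately show ?thesis by (simp only: B_def times_divide_eq_left)
  qed
  have B_nonneg: "0 \<le> B / real N" by (simp add: B_def)
  have half: "B / real N \<le> 1 / 2" using N by (simp add: B_def field_simps)
  have h: "0 \<le> ?h j" "?h j \<le> B / real N" "?y j \<le> 1 / 2" if "j \<in> {1..N}" for j
  proof -
    have "?y j \<le> B / real N" by (rule order_trans[OF abs_ge_self y[OF that]])
    then show "?h j \<le> B / real N" "?y j \<le> 1 / 2"
      using max.boundedI[OF B_nonneg] order_trans[OF _ half] by blast+
  qed simp
  have S: "S = (\<Sum>j=1..N. ?h j)"
    unfolding S_def sum_distrib_left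
    by (intro sum.cong refl) (simp add: max_mult_distrib_left)
  have split: "(\<Sum>j=1..N. ?h j) = (\<Sum>j\<in>R. ?h j) + (\<Sum>j\<in>{1..N} - R. ?h j)"
    using R by (subst sum.subset_diff[of R "{1..N}"]) auto
  have "card ({1..N} - R) \<le> 2" using R by (subst card_Diff_subset) (auto simp: fin)
  then have "real (card ({1..N} - R)) * (B / real N) \<le> 2 * (B / real N)"
    by (intro mult_right_mono B_nonneg) auto
  moreover have "(\<Sum>j\<in>{1..N} - R. ?h j) \<le> real (card ({1..N} - R)) * (B / real N)"
    by (intro sum_bounded_above) (use h in blast)
  ultimately have excl: "(\<Sum>j\<in>{1..N} - R. ?h j) \<le> 2 * B / real N" by simp
  have "(\<Sum>j\<in>{1..N} - R. ?h j) \<ge> 0" by (intro sum_nonneg) auto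
  then have sum_le: "(\<Sum>j\<in>R. ?h j) \<le> S" using S split by simp
  have sum_ge: "S - 2 * B / real N \<le> (\<Sum>j\<in>R. ?h j)" using S split excl by simp
  have "(\<Sum>j\<in>R. (?h j)\<^sup>2) \<le> real (card R) * (B / real N)\<^sup>2"
    by (intro sum_bounded_above power_mono) (use h R in blast)+
  also have "\<dots> \<le> real N * (B / real N)\<^sup>2"
    using card_mono[OF _ R(1)] by (intro mult_right_mono) auto
  also have "\<dots> = B\<^sup>2 / real N" using pos by (simp add: power2_eq_square)
  finally have sq: "(\<Sum>j\<in>R. (?h j)\<^sup>2) \<le> B\<^sup>2 / real N" .
  have "exp (- S - 2 * B\<^sup>2 / real N) \<le> exp (- (\<Sum>j\<in>R. ?h j) - 2 * (\<Sum>j\<in>R. (?h j)\<^sup>2))"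
    using sum_le sq by simp
  also have "\<dots> = (\<Prod>j\<in>R. exp (- ?h j - 2 * (?h j)\<^sup>2))"
    by (simp add: exp_sum[OF fin, symmetric] sum_subtractf sum_negf sum_distrib_left)
  also have "\<dots> \<le> (\<Prod>j\<in>R. unif01_cdf (1 - ?y j))"
    using h R by (intro prod_mono) (auto intro!: unif01_cdf_ge_exp)
  finally show "exp (- S - 2 * B\<^sup>2 / real N) \<le> (\<Prod>j\<in>R. unif01_cdf (1 - ?y j))" .
  have "(\<Prod>j\<in>R. unif01_cdf (1 - ?y j)) \<le> (\<Prod>j\<in>R. exp (- ?h j))"
    using h R by (intro prod_mono) (auto intro!: unif01_cdf_le_exp simp: unif01_cdf_bounds)
  also have "\<dots> = exp (- (\<Sum>j\<in>R. ?h j))"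
    by (simp add: exp_sum[OF fin, symmetric] sum_negf)
  also have "\<dots> \<le> exp (- S + 2 * B / real N)" using sum_ge by simp
  finally show "(\<Prod>j\<in>R. unif01_cdf (1 - ?y j)) \<le> exp (- S + 2 * B / real N)" .
qed

lemma prod_unif01_cdf_tendsto:
  assumes "k \<noteq> 0" "0 \<le> c"
  shows "(\<lambda>N. \<Prod>j\<in>{1..N} - {n1 N, n2 N}. unif01_cdf (1 - 2 / real N * (c + k * tooth_pos N j)))
    \<longlonglongrightarrow> exp (- hinge_area k c)"
proof (rule tendsto_sandwich)
  define B where "B = 2 * (\<bar>c\<bar> + \<bar>k\<bar>)"
  define S where "S N = 2 / real N * (\<Sum>j=1..N. max 0 (c + k * tooth_pos N j))" for N
  have "\<bar>max 0 (c + k * x) - max 0 (c + k * y)\<bar> \<le> \<bar>k\<bar> * \<bar>x - y\<bar>" for x y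
    using abs_max_0_diff_le[of "c + k * x" "c + k * y"] by (simp add: abs_mult[symmetric] algebra_simps)
  then have S: "S \<longlonglongrightarrow> hinge_area k c"
    unfolding S_def integral_hinge[OF assms, symmetric] by (rule riemann_sum_tooth_pos) auto
  have "(\<lambda>N. exp (- S N - 2 * B\<^sup>2 / real N)) \<longlonglongrightarrow> exp (- hinge_area k c - 0)"
    by (intro tendsto_intros S lim_const_over_n)
  then show "(\<lambda>N. exp (- S N - 2 * B\<^sup>2 / real N)) \<longlonglongrightarrow> exp (- hinge_area k c)" by simp
  have "(\<lambda>N. exp (- S N + 2 * B / real N)) \<longlonglongrightarrow> exp (- hinge_area k c + 0)"
    by (intro tendsto_intros S lim_const_over_n)
  then show "(\<lambda>N. exp (- S N + 2 * B / real N)) \<longlonglongrightarrow> exp (- hinge_area k c)" by simp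
  have card: "N \<le> card ({1..N} - {n1 N, n2 N}) + 2" for N
  proof -
    have "card {1..N} - card {n1 N, n2 N} \<le> card ({1..N} - {n1 N, n2 N})" by (rule diff_card_le_card_Diff) auto
    moreover have "card {n1 N, n2 N} \<le> 2" by (simp add: card_insert_if)
    ultimately show ?thesis by simp
  qed
  have large: "\<forall>\<^sub>F N in sequentially. 4 * (\<bar>c\<bar> + \<bar>k\<bar>) \<le> real N \<and> 0 < N"
    by (intro eventually_conj eventually_gt_at_top eventually_compose_filterlim[OF eventually_ge_at_top filterlim_real_sequentially])
  show "\<forall>\<^sub>F N in sequentially. exp (- S N - 2 * B\<^sup>2 / real N) \<le>
      (\<Prod>j\<in>{1..N} - {n1 N, n2 N}. unif01_cdf (1 - 2 / real N * (c + k * tooth_pos N j)))"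
    using large by eventually_elim (auto simp only: S_def B_def intro!: prod_unif01_cdf_bounds card)
  show "\<forall>\<^sub>F N in sequentially.
      (\<Prod>j\<in>{1..N} - {n1 N, n2 N}. unif01_cdf (1 - 2 / real N * (c + k * tooth_pos N j))) \<le> exp (- S N + 2 * B / real N)"
    using large by eventually_elim (auto simp only: S_def B_def intro!: prod_unif01_cdf_bounds card)
qed

definition limit_integrand :: "real \<Rightarrow> real \<Rightarrow> real \<Rightarrow> real \<Rightarrow> real" where
  "limit_integrand a1 a2 k c = exp (- hinge_area k c) * indicator {0..} (c + k * a1) * indicator {0..} (c + k * a2)"

lemma borel_measurable_limit_integrand [measurable]:
  "(\<lambda>x. limit_integrand a1 a2 (f x) (g x)) \<in> borel_measurable M"
  if [measurable]: "f \<in> borel_measurable M" "g \<in> borel_measurable M"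
  unfolding limit_integrand_def by measurable

text \<open>The upper end of the unit interval restricts the height of the line at a supporting tooth in the
limit; the lower end is never reached. At \<open>t = 0\<close> the limit may fail to exist, which later costs
a null set of lines.\<close>

lemma indicator_unit_interval_tendsto:
  assumes h: "h \<longlonglongrightarrow> t" and "t \<noteq> 0"
  shows "(\<lambda>N. indicat_real {0..1} (1 - 2 / real N * h N)) \<longlonglongrightarrow> indicator {0..} t"
proof (rule tendsto_eventually, cases "0 < t")
  case True
  have "(\<lambda>N. 2 / real N * h N) \<longlonglongrightarrow> 0 * t"
    by (intro tendsto_mult h lim_const_over_n)
  then have "\<forall>\<^sub>F N in sequentially. 2 / real N * h N < 1"
    by (rule order_tendstoD) simp
  moreover have "\<forall>\<^sub>F N in sequentially. 0 < h N"
    using h True by (rule order_tendstoD)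
  ultimately show "\<forall>\<^sub>F N in sequentially. indicat_real {0..1} (1 - 2 / real N * h N) = indicator {0..} t"
    by eventually_elim (use True in \<open>auto simp: indicator_def\<close>)
next
  case False
  then have "t < 0" using assms by simp
  with h have "\<forall>\<^sub>F N in sequentially. h N < 0"
    by (rule order_tendstoD)
  then show "\<forall>\<^sub>F N in sequentially. indicat_real {0..1} (1 - 2 / real N * h N) = indicator {0..} t"
    using eventually_gt_at_top[of 0]
  proof eventually_elim
    case (elim N)
    then have "2 / real N * h N < 0" by (intro mult_pos_neg) auto
    then show ?case using False assms by (auto simp: indicator_def)
  qed
qed

text \<open>For \<open>c < 0\<close> the formula for the area is not available, but since \<open>a1 \<le> 0 \<le> a2\<close> one of the two
indicators then tends to \<open>0\<close>.\<close>

lemma scaled_density_tendsto: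
  assumes adm: "\<forall>\<^sub>F N in sequentially. admissible N (n1 N) (n2 N)"
    and lim: "(\<lambda>N. tooth_pos N (n1 N)) \<longlonglongrightarrow> a1" "(\<lambda>N. tooth_pos N (n2 N)) \<longlonglongrightarrow> a2"
    and a: "a1 \<le> 0" "0 \<le> a2"
    and ne: "k \<noteq> 0" "c + k * a1 \<noteq> 0" "c + k * a2 \<noteq> 0"
  shows "(\<lambda>N. scaled_density N (n1 N) (n2 N) k c) \<longlonglongrightarrow> limit_integrand a1 a2 k c"
proof -
  let ?P = "\<lambda>N. \<Prod>j\<in>{1..N} - {n1 N, n2 N}. unif01_cdf (1 - 2 / real N * (c + k * tooth_pos N j))"
  let ?I = "\<lambda>n N. indicat_real {0..1} (1 - 2 / real N * (c + k * tooth_pos N (n N)))"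
  have I: "?I n1 \<longlonglongrightarrow> indicator {0..} (c + k * a1)" "?I n2 \<longlonglongrightarrow> indicator {0..} (c + k * a2)"
    by (intro indicator_unit_interval_tendsto tendsto_intros lim ne)+
  have II: "(\<lambda>N. ?I n1 N * ?I n2 N) \<longlonglongrightarrow> indicator {0..} (c + k * a1) * indicator {0..} (c + k * a2)"
    by (intro tendsto_mult I)
  have "(\<lambda>N. ?P N * (?I n1 N * ?I n2 N)) \<longlonglongrightarrow> limit_integrand a1 a2 k c"
  proof (cases "0 \<le> c")
    case True
    show ?thesis
      unfolding limit_integrand_def mult.assoc
      by (intro tendsto_mult[OF prod_unif01_cdf_tendsto II] ne True)
  next
    case False
    have "c + k * a1 < 0 \<or> c + k * a2 < 0"
      using False a mult_nonneg_nonpos[of k a1] mult_nonpos_nonneg[of k a2] by linarith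
    then have ind: "indicat_real {0..} (c + k * a1) * indicator {0..} (c + k * a2) = 0"
      by (auto simp: indicator_def)
    have "(\<lambda>N. ?P N * (?I n1 N * ?I n2 N)) \<longlonglongrightarrow> 0"
    proof (rule Lim_null_comparison)
      show "\<forall>\<^sub>F N in sequentially. norm (?P N * (?I n1 N * ?I n2 N)) \<le> ?I n1 N * ?I n2 N"
        by (intro always_eventually allI)
           (auto simp: abs_mult indicator_def abs_of_nonneg prod_nonneg unif01_cdf_bounds intro!: prod_le_1)
      show "(\<lambda>N. ?I n1 N * ?I n2 N) \<longlonglongrightarrow> 0" using II unfolding ind .
    qed
    then show ?thesis unfolding limit_integrand_def mult.assoc ind mult_zero_right .
  qed
  moreover have "\<forall>\<^sub>F N in sequentially. ?P N * (?I n1 N * ?I n2 N) = scaled_density N (n1 N) (n2 N) k c"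
    using adm by eventually_elim (use admissible_less(1) in \<open>force simp: scaled_density_def\<close>)
  ultimately show ?thesis
    by (rule Lim_transform_eventually)
qed

section \<open>The limit of the integral\<close>

lemma AE_pair_affine_nonzero:
  "AE x in (lborel \<Otimes>\<^sub>M lborel :: (real \<times> real) measure). fst x \<noteq> 0 \<and> snd x + fst x * a \<noteq> 0 \<and> snd x + fst x * b \<noteq> 0"
proof (rule lborel_pair.AE_pair_measure)
  show "AE k in lborel. AE c in lborel. fst (k, c) \<noteq> 0 \<and> snd (k, c) + fst (k, c) * a \<noteq> 0 \<and> snd (k, c) + fst (k, c) * b \<noteq> 0"
    using AE_lborel_singleton[of "0 :: real"]
  proof eventually_elim
    case (elim k)
    have "AE c in lborel. c \<noteq> - (k * a) \<and> c \<noteq> - (k * b)"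
      by (intro AE_conjI AE_lborel_singleton)
    then show ?case
      by eventually_elim (use elim in \<open>auto simp: add_eq_0_iff\<close>)
  qed
qed measurable

lemma nn_integral_scaled_density_tendsto:
  assumes adm: "\<forall>\<^sub>F N in sequentially. admissible N (n1 N) (n2 N)"
    and lim: "(\<lambda>N. tooth_pos N (n1 N)) \<longlonglongrightarrow> a1" "(\<lambda>N. tooth_pos N (n2 N)) \<longlonglongrightarrow> a2"
    and a: "a1 \<le> 0" "0 \<le> a2"
  shows "(\<lambda>N. \<integral>\<^sup>+k. \<integral>\<^sup>+c. ennreal (scaled_density N (n1 N) (n2 N) k c) \<partial>lborel \<partial>lborel) \<longlonglongrightarrow>
    (\<integral>\<^sup>+k. \<integral>\<^sup>+c. ennreal (limit_integrand a1 a2 k c) \<partial>lborel \<partial>lborel)"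
proof -
  let ?L = "lborel \<Otimes>\<^sub>M lborel :: (real \<times> real) measure"
  let ?f = "\<lambda>N x. ennreal (scaled_density N (n1 N) (n2 N) (fst x) (snd x))"
  let ?g = "\<lambda>x. ennreal (limit_integrand a1 a2 (fst x) (snd x))"
  obtain N0 where N0: "\<And>N. N0 \<le> N \<Longrightarrow> admissible N (n1 N) (n2 N)"
    using adm by (auto simp: eventually_sequentially)
  \<comment> \<open>The bound is available for combs with at least \<open>24\<close> teeth; earlier members are skipped.\<close>
  define m where "m = N0 + 24"
  have "(\<lambda>i. \<integral>\<^sup>+x. ?f (i + m) x \<partial>?L) \<longlonglongrightarrow> (\<integral>\<^sup>+x. ?g x \<partial>?L)"
  proof (rule nn_integral_dominated_convergence)
    show "AE x in ?L. ?f (i + m) x \<le> ennreal (indicator {0..} (snd x) * exp (- (snd x + \<bar>fst x\<bar> / 2) / 4))" for i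
      by (intro AE_I2 ennreal_leI scaled_density_le N0) (simp_all add: m_def)
    show "AE x in ?L. (\<lambda>i. ?f (i + m) x) \<longlonglongrightarrow> ?g x"
      using AE_pair_affine_nonzero[of a1 a2]
    proof eventually_elim
      case (elim x)
      then have "(\<lambda>N. ?f N x) \<longlonglongrightarrow> ?g x"
        by (intro tendsto_ennrealI scaled_density_tendsto adm lim a) auto
      then show ?case by (rule LIMSEQ_ignore_initial_segment)
    qed
    show "(\<integral>\<^sup>+x. ennreal (indicator {0..} (snd x) * exp (- (snd x + \<bar>fst x\<bar> / 2) / 4)) \<partial>?L) < \<infinity>"
      by (rule nn_integral_dominating_function)
  qed simp_all
  then have "(\<lambda>N. \<integral>\<^sup>+x. ?f N x \<partial>?L) \<longlonglongrightarrow> (\<integral>\<^sup>+x. ?g x \<partial>?L)"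
    by (rule LIMSEQ_offset)
  moreover have "(\<integral>\<^sup>+x. ?f N x \<partial>?L) = (\<integral>\<^sup>+k. \<integral>\<^sup>+c. ennreal (scaled_density N (n1 N) (n2 N) k c) \<partial>lborel \<partial>lborel)" for N
    by (subst lborel.nn_integral_fst[symmetric]) simp_all
  moreover have "(\<integral>\<^sup>+x. ?g x \<partial>?L) = (\<integral>\<^sup>+k. \<integral>\<^sup>+c. ennreal (limit_integrand a1 a2 k c) \<partial>lborel \<partial>lborel)"
    by (subst lborel.nn_integral_fst[symmetric]) simp_all
  ultimately show ?thesis by simp
qed

section \<open>The value of the limit integral\<close>

text \<open>The area of the hinge with unit slope is \<open>(1 + z)\<^sup>2/2\<close> for \<open>z \<le> 1\<close>, where the hinge vanishes on
part of the interval, and \<open>2 z\<close> for \<open>z \<ge> 1\<close>, where it does not. The second range gives the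
\<open>1/4\<close>, of which the lower-order term of the first range takes away \<open>1/6\<close>.\<close>

lemma nn_integral_inverse_square_hinge_area:
  assumes b: "0 \<le> b" "b \<le> 1"
  shows "(\<integral>\<^sup>+z. ennreal (1 / (hinge_area 1 z)\<^sup>2) * indicator {b..} z \<partial>lborel) = ennreal (4 / (3 * (1 + b) ^ 3) + 1 / 12)"
proof -
  have "(\<integral>\<^sup>+z. ennreal (1 / (hinge_area 1 z)\<^sup>2) * indicator {b..} z \<partial>lborel) =
      (\<integral>\<^sup>+z. ennreal (4 / (1 + z) ^ 4) * indicator {b..1} z + ennreal (1 / (4 * z\<^sup>2)) * indicator {1..} z \<partial>lborel)"
  proof (rule nn_integral_cong_AE)
    have "1 / (hinge_area 1 z)\<^sup>2 = 4 / (1 + z) ^ 4" if "z < 1" for z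
      using that by (simp add: hinge_area_def power_divide add.commute flip: power_mult)
    moreover have "1 / (hinge_area 1 z)\<^sup>2 = 1 / (4 * z\<^sup>2)" if "1 < z" for z
    proof -
      have "hinge_area 1 z = 2 * z" using that by (simp add: hinge_area_def power2_eq_square algebra_simps)
      then show ?thesis by simp
    qed
    ultimately have "ennreal (1 / (hinge_area 1 z)\<^sup>2) * indicator {b..} z =
        ennreal (4 / (1 + z) ^ 4) * indicator {b..1} z + ennreal (1 / (4 * z\<^sup>2)) * indicator {1..} z" if "z \<noteq> 1" for z
      using that b by (cases "z < 1") (auto simp: indicator_def)
    then show "AE z in lborel. ennreal (1 / (hinge_area 1 z)\<^sup>2) * indicator {b..} z =
        ennreal (4 / (1 + z) ^ 4) * indicator {b..1} z + ennreal (1 / (4 * z\<^sup>2)) * indicator {1..} z"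
      using AE_lborel_singleton[of "1 :: real"] by (auto elim!: eventually_mono)
  qed
  also have "\<dots> = (\<integral>\<^sup>+z. ennreal (4 / (1 + z) ^ 4) * indicator {b..1} z \<partial>lborel) +
      (\<integral>\<^sup>+z. ennreal (1 / (4 * z\<^sup>2)) * indicator {1..} z \<partial>lborel)"
    by (intro nn_integral_add) auto
  also have "(\<integral>\<^sup>+z. ennreal (1 / (4 * z\<^sup>2)) * indicator {1..} z \<partial>lborel) = ennreal (0 - (- 1 / (4 * 1)))"
  proof (rule nn_integral_FTC_atLeast[where F = "\<lambda>x. - 1 / (4 * x)"])
    fix x :: real assume "1 \<le> x"
    then show "((\<lambda>x. - 1 / (4 * x)) has_real_derivative 1 / (4 * x\<^sup>2)) (at x)"
      by (auto intro!: derivative_eq_intros simp: power2_eq_square)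
  next
    show "((\<lambda>x::real. - 1 / (4 * x)) \<longlongrightarrow> 0) at_top"
      by (intro tendsto_divide_0[OF tendsto_const] filterlim_at_top_imp_at_infinity
          filterlim_tendsto_pos_mult_at_top[OF tendsto_const _ filterlim_ident]) simp
  qed auto
  also have "(\<integral>\<^sup>+z. ennreal (4 / (1 + z) ^ 4) * indicator {b..1} z \<partial>lborel) =
      ennreal (- 4 / (3 * (1 + 1) ^ 3) - (- 4 / (3 * (1 + b) ^ 3)))"
  proof (rule nn_integral_FTC_Icc[where F = "\<lambda>x. - 4 / (3 * (1 + x) ^ 3)"])
    fix x :: real assume "x \<in> {b..1}"
    then have "1 + x \<noteq> 0" using b by simp
    then show "((\<lambda>x. - 4 / (3 * (1 + x) ^ 3)) has_real_derivative 4 / (1 + x) ^ 4) (at x)"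
      by (auto intro!: derivative_eq_intros simp: divide_simps eval_nat_numeral)
  qed (use b in auto)
  also have "ennreal (- 4 / (3 * (1 + 1) ^ 3) - (- 4 / (3 * (1 + b) ^ 3))) + ennreal (0 - (- 1 / (4 * 1))) =
      ennreal (4 / (3 * (1 + b) ^ 3) + 1 / 12)"
  proof -
    have "(1 + b) ^ 3 \<le> (1 + 1) ^ 3" using b by (intro power_mono) auto
    moreover have "0 < (1 + b) ^ 3" using b by simp
    ultimately have "4 / (3 * 2 ^ 3) \<le> 4 / (3 * (1 + b) ^ 3)" by (intro divide_left_mono) auto
    then show ?thesis by (subst ennreal_plus[symmetric]) auto
  qed
  finally show ?thesis .
qed

text \<open>The area is homogeneous, \<open>hinge_area k (k z) = k * hinge_area 1 z\<close>, and the wedge \<open>c \<ge> k b\<close>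
becomes the half-line \<open>z \<ge> b\<close> under \<open>c = k z\<close>. Integrating over \<open>k\<close> first leaves the inverse
square of the area.\<close>

lemma nn_integral_hinge_wedge:
  assumes b: "0 \<le> b" "b \<le> 1"
  shows "(\<integral>\<^sup>+k. (\<integral>\<^sup>+c. ennreal (exp (- hinge_area k c)) * indicator {k * b..} c \<partial>lborel) * indicator {0<..} k \<partial>lborel) =
    ennreal (4 / (3 * (1 + b) ^ 3) + 1 / 12)"
proof -
  have l_pos: "0 < hinge_area 1 z" if "0 \<le> z" for z
  proof -
    have "(max 0 (z - 1))\<^sup>2 < (z + 1)\<^sup>2" using that by (intro power_strict_mono) auto
    then show ?thesis by (simp add: hinge_area_def)
  qed
  have scale: "hinge_area k (k * z) = hinge_area 1 z * k" if "0 < k" for k z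
  proof -
    have "max 0 (k * z - k) = k * max 0 (z - 1)" using that by (simp add: max_mult_distrib_left algebra_simps)
    moreover have "k * z + k = k * (z + 1)" by (simp add: algebra_simps)
    ultimately show ?thesis using that
      by (simp add: hinge_area_def hinge_area_def power_mult_distrib field_simps power2_eq_square)
  qed
  have "(\<integral>\<^sup>+k. (\<integral>\<^sup>+c. ennreal (exp (- hinge_area k c)) * indicator {k * b..} c \<partial>lborel) * indicator {0<..} k \<partial>lborel) =
      (\<integral>\<^sup>+k. (\<integral>\<^sup>+z. ennreal (k * exp (- (hinge_area 1 z * k))) * indicator {0..} k * indicator {b..} z \<partial>lborel) \<partial>lborel)"
  proof (intro nn_integral_cong_AE eventually_mono[OF AE_lborel_singleton[of 0]])
    fix k :: real assume "k \<noteq> 0"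
    show "(\<integral>\<^sup>+c. ennreal (exp (- hinge_area k c)) * indicator {k * b..} c \<partial>lborel) * indicator {0<..} k =
        (\<integral>\<^sup>+z. ennreal (k * exp (- (hinge_area 1 z * k))) * indicator {0..} k * indicator {b..} z \<partial>lborel)"
    proof (cases "0 < k")
      case True
      have "(\<integral>\<^sup>+c. ennreal (exp (- hinge_area k c)) * indicator {k * b..} c \<partial>lborel) =
          ennreal k * (\<integral>\<^sup>+z. ennreal (exp (- (hinge_area 1 z * k))) * indicator {b..} z \<partial>lborel)"
        using True by (subst nn_integral_real_affine[where c = k and t = 0]) (auto simp: scale indicator_def)
      also have "\<dots> = (\<integral>\<^sup>+z. ennreal k * (ennreal (exp (- (hinge_area 1 z * k))) * indicator {b..} z) \<partial>lborel)"
        by (rule nn_integral_cmult[symmetric]) measurable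
      finally show ?thesis
        using True by (simp add: ennreal_mult' mult.assoc)
    qed (use \<open>k \<noteq> 0\<close> in auto)
  qed
  also have "\<dots> = (\<integral>\<^sup>+z. (\<integral>\<^sup>+k. ennreal (k * exp (- (hinge_area 1 z * k))) * indicator {0..} k * indicator {b..} z \<partial>lborel) \<partial>lborel)"
    by (intro lborel_pair.Fubini'[symmetric]) measurable
  also have "\<dots> = (\<integral>\<^sup>+z. ennreal (1 / (hinge_area 1 z)\<^sup>2) * indicator {b..} z \<partial>lborel)"
  proof (intro nn_integral_cong)
    fix z
    show "(\<integral>\<^sup>+k. ennreal (k * exp (- (hinge_area 1 z * k))) * indicator {0..} k * indicator {b..} z \<partial>lborel) =
        ennreal (1 / (hinge_area 1 z)\<^sup>2) * indicator {b..} z"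
    proof (cases "b \<le> z")
      case True
      then show ?thesis
        using b nn_integral_power_exp[OF l_pos[of z], of 1] by (simp add: power2_eq_square)
    qed simp
  qed
  also have "\<dots> = ennreal (4 / (3 * (1 + b) ^ 3) + 1 / 12)"
    by (rule nn_integral_inverse_square_hinge_area[OF b])
  finally show ?thesis .
qed

text \<open>For \<open>k > 0\<close> the line \<open>c + k x\<close> increases, so nonnegativity at \<open>a1\<close> implies that at \<open>a2\<close>; for
\<open>k < 0\<close> it is the other way round. Reflecting \<open>k\<close> gives two wedges, with parameters \<open>- a1\<close> and
\<open>a2\<close>.\<close>

lemma nn_integral_limit_integrand:
  assumes a: "a1 \<in> {-1..0}" "a2 \<in> {0..1}"
  shows "(\<integral>\<^sup>+k. \<integral>\<^sup>+c. ennreal (limit_integrand a1 a2 k c) \<partial>lborel \<partial>lborel) =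
    ennreal (4 / (3 * (1 + a2) ^ 3) + 4 / (3 * (1 - a1) ^ 3) + 1 / 6)"
proof -
  define F where "F k = (\<integral>\<^sup>+c. ennreal (limit_integrand a1 a2 k c) \<partial>lborel)" for k
  have [measurable]: "F \<in> borel_measurable borel"
    unfolding F_def[abs_def] by measurable
  define J where "J b = (\<integral>\<^sup>+k. (\<integral>\<^sup>+c. ennreal (exp (- hinge_area k c)) * indicator {k * b..} c \<partial>lborel) * indicator {0<..} k \<partial>lborel)" for b
  have "(\<integral>\<^sup>+k. F k \<partial>lborel) = (\<integral>\<^sup>+k. F k * indicator {0<..} k + F k * indicator {..<0} k \<partial>lborel)"
    by (intro nn_integral_cong_AE eventually_mono[OF AE_lborel_singleton[of 0]]) (auto simp: indicator_def)
  also have "\<dots> = (\<integral>\<^sup>+k. F k * indicator {0<..} k \<partial>lborel) + (\<integral>\<^sup>+k. F k * indicator {..<0} k \<partial>lborel)"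
    by (intro nn_integral_add) auto
  also have "(\<integral>\<^sup>+k. F k * indicator {..<0} k \<partial>lborel) = (\<integral>\<^sup>+k. F (- k) * indicator {0<..} k \<partial>lborel)"
    by (subst nn_integral_real_affine[where c = "-1" and t = 0]) (auto simp: indicator_def)
  also have "(\<integral>\<^sup>+k. F k * indicator {0<..} k \<partial>lborel) = J (- a1)"
    unfolding J_def
  proof (intro nn_integral_cong)
    fix k :: real
    have "F k = (\<integral>\<^sup>+c. ennreal (exp (- hinge_area k c)) * indicator {k * (- a1)..} c \<partial>lborel)" if "0 < k"
      unfolding F_def
    proof (intro nn_integral_cong)
      fix c
      have "k * a1 \<le> 0" "0 \<le> k * a2" using that a by (auto intro: mult_nonneg_nonpos)
      then show "ennreal (limit_integrand a1 a2 k c) = ennreal (exp (- hinge_area k c)) * indicator {k * (- a1)..} c"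
        by (auto simp: limit_integrand_def indicator_def)
    qed
    then show "F k * indicator {0<..} k = (\<integral>\<^sup>+c. ennreal (exp (- hinge_area k c)) * indicator {k * (- a1)..} c \<partial>lborel) * indicator {0<..} k"
      by (auto simp: indicator_def)
  qed
  also have "(\<integral>\<^sup>+k. F (- k) * indicator {0<..} k \<partial>lborel) = J a2"
    unfolding J_def
  proof (intro nn_integral_cong)
    fix k :: real
    have "F (- k) = (\<integral>\<^sup>+c. ennreal (exp (- hinge_area k c)) * indicator {k * a2..} c \<partial>lborel)" if "0 < k"
      unfolding F_def
    proof (intro nn_integral_cong)
      fix c
      have "k * a1 \<le> 0" "0 \<le> k * a2" using that a by (auto intro: mult_nonneg_nonpos)
      then show "ennreal (limit_integrand a1 a2 (- k) c) = ennreal (exp (- hinge_area k c)) * indicator {k * a2..} c"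
        by (auto simp: limit_integrand_def indicator_def hinge_area_def)
    qed
    then show "F (- k) * indicator {0<..} k = (\<integral>\<^sup>+c. ennreal (exp (- hinge_area k c)) * indicator {k * a2..} c \<partial>lborel) * indicator {0<..} k"
      by (auto simp: indicator_def)
  qed
  also have "J (- a1) + J a2 = ennreal (4 / (3 * (1 + a2) ^ 3) + 4 / (3 * (1 - a1) ^ 3) + 1 / 6)"
    using a unfolding J_def by (subst (1 2) nn_integral_hinge_wedge) (auto simp: ennreal_plus[symmetric] simp del: ennreal_plus)
  finally show ?thesis unfolding F_def .
qed

section \<open>The limit density\<close>

lemma support_prob_tendsto:
  fixes M :: "nat \<Rightarrow> 'a measure" and \<xi> :: "nat \<Rightarrow> nat \<Rightarrow> 'a \<Rightarrow> real"
  assumes comb: "\<And>N. N \<ge> 2 \<Longrightarrow> random_comb N (M N) (\<xi> N)"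
    and adm: "\<And>N. N \<ge> 2 \<Longrightarrow> admissible N (n1 N) (n2 N)"
    and lim: "(\<lambda>N. tooth_pos N (n1 N)) \<longlonglongrightarrow> a1" "(\<lambda>N. tooth_pos N (n2 N)) \<longlonglongrightarrow> a2"
    and a: "a1 \<in> {-1..0}" "a2 \<in> {0..1}"
  shows "(\<lambda>N. real N ^ 2 / 4 * support_prob N (M N) (\<xi> N) (n1 N) (n2 N)) \<longlonglongrightarrow>
    (a2 - a1) * (4 / (3 * (1 + a2) ^ 3) + 4 / (3 * (1 - a1) ^ 3) + 1 / 6)" (is "_ \<longlonglongrightarrow> _ * ?p")
proof -
  let ?X = "\<lambda>N. \<integral>\<^sup>+k. \<integral>\<^sup>+c. ennreal (scaled_density N (n1 N) (n2 N) k c) \<partial>lborel \<partial>lborel"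
  have p: "0 \<le> ?p" using a by simp
  have "?X \<longlonglongrightarrow> ennreal ?p"
    unfolding nn_integral_limit_integrand[OF a, symmetric]
    using a adm by (intro nn_integral_scaled_density_tendsto lim eventually_sequentiallyI[of 2]) auto
  then have X: "(\<lambda>N. enn2real (?X N)) \<longlonglongrightarrow> ?p"
    using tendsto_enn2real[OF _ p] by blast
  have "(\<lambda>N. (tooth_pos N (n2 N) - tooth_pos N (n1 N)) * enn2real (?X N)) \<longlonglongrightarrow> (a2 - a1) * ?p"
    by (intro tendsto_mult tendsto_diff lim X)
  moreover have "\<forall>\<^sub>F N in sequentially. (tooth_pos N (n2 N) - tooth_pos N (n1 N)) * enn2real (?X N) =
      real N ^ 2 / 4 * support_prob N (M N) (\<xi> N) (n1 N) (n2 N)"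
  proof (rule eventually_sequentiallyI[of 2])
    fix N :: nat assume N: "2 \<le> N"
    note n = admissible_less[OF adm[OF N]]
    have "tooth_pos N (n1 N) < tooth_pos N (n2 N)" using tooth_pos_less n by blast
    then have "support_prob N (M N) (\<xi> N) (n1 N) (n2 N) =
        (2 / real N)\<^sup>2 * (tooth_pos N (n2 N) - tooth_pos N (n1 N)) * enn2real (?X N)"
      unfolding support_prob_def measure_def emeasure_supported_by_eq[OF comb[OF N] adm[OF N]] enn2real_mult
      by (subst enn2real_ennreal) auto
    then show "(tooth_pos N (n2 N) - tooth_pos N (n1 N)) * enn2real (?X N) =
        real N ^ 2 / 4 * support_prob N (M N) (\<xi> N) (n1 N) (n2 N)"
      using N by (simp add: power2_eq_square)
  qed
  ultimately show ?thesis by (rule Lim_transform_eventually)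
qed

lemma tooth_pos_tendstoI:
  assumes "\<And>N. N \<ge> 2 \<Longrightarrow> \<bar>real (n N) - real N * (1 + a) / 2\<bar> \<le> 1"
  shows "(\<lambda>N. tooth_pos N (n N)) \<longlonglongrightarrow> a"
proof -
  have "(\<lambda>N. tooth_pos N (n N) - a) \<longlonglongrightarrow> 0"
  proof (rule Lim_null_comparison)
    show "\<forall>\<^sub>F N in sequentially. norm (tooth_pos N (n N) - a) \<le> 2 / real N"
    proof (rule eventually_sequentiallyI[of 2])
      fix N :: nat assume N: "2 \<le> N"
      then have "tooth_pos N (n N) - a = 2 / real N * (real (n N) - real N * (1 + a) / 2)"
        by (simp add: tooth_pos_def field_simps)
      then have "norm (tooth_pos N (n N) - a) = 2 / real N * \<bar>real (n N) - real N * (1 + a) / 2\<bar>"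
        by (simp only: real_norm_def abs_mult) simp
      also have "\<dots> \<le> 2 / real N * 1"
        by (intro mult_left_mono assms N) simp
      finally show "norm (tooth_pos N (n N) - a) \<le> 2 / real N" by simp
    qed
    show "(\<lambda>N. 2 / real N) \<longlonglongrightarrow> 0" by (rule lim_const_over_n)
  qed
  then show ?thesis by (simp add: LIM_zero_iff)
qed

text \<open>The tooth next to the left of \<open>a\<close> need not be admissible: near the left end it would have the
number \<open>0\<close>, and near the centre the second tooth would lie on the wrong side. The maxima correct
this by at most one tooth.\<close>

lemma admissible_sequences_exist:
  assumes a: "a1 \<in> {-1..0}" "a2 \<in> {0..1}"
  obtains n1 n2 where "\<And>N. N \<ge> 2 \<Longrightarrow> admissible N (n1 N) (n2 N)"
    "(\<lambda>N. tooth_pos N (n1 N)) \<longlonglongrightarrow> a1" "(\<lambda>N. tooth_pos N (n2 N)) \<longlonglongrightarrow> a2"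
proof -
  define t where "t a N = real N * (1 + a) / 2" for a :: real and N :: nat
  define n1 where "n1 N = max 1 (nat \<lfloor>t a1 N\<rfloor>)" for N
  define n2 where "n2 N = max (N div 2 + 1) (nat \<lfloor>t a2 N\<rfloor>)" for N
  have t1: "0 \<le> t a1 N" "t a1 N \<le> real N / 2" for N
    using a mult_left_mono[of "1 + a1" 1 "real N"] by (auto simp: t_def)
  have t2: "real N / 2 \<le> t a2 N" "t a2 N \<le> real N" for N
    using a mult_left_mono[of 1 "1 + a2" "real N"] mult_left_mono[of "1 + a2" 2 "real N"] by (auto simp: t_def)
  have floor: "real (nat \<lfloor>x\<rfloor>) \<le> x" "x < real (nat \<lfloor>x\<rfloor>) + 1" if "0 \<le> x" for x
    using that by linarith+
  have t2_nonneg: "0 \<le> t a2 N" for N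
    using t2(1)[of N] by (rule order_trans[rotated]) simp
  have half: "real N / 2 < real (N div 2 + 1)" "real (N div 2 + 1) \<le> real N / 2 + 1" for N
    by linarith+
  show thesis
  proof (rule that)
    fix N :: nat assume N: "2 \<le> N"
    have "real (n1 N) \<le> real N / 2"
      using N floor(1)[OF t1(1)[of N]] t1(2)[of N] by (auto simp: n1_def max_def)
    moreover have "real (nat \<lfloor>t a2 N\<rfloor>) \<le> real N"
      using floor(1)[OF t2_nonneg] t2(2) by (rule order_trans)
    then have "n2 N \<le> N"
      using N by (simp add: n2_def)
    moreover have "real N / 2 < real (n2 N)"
      using half(1)[of N] by (auto simp: n2_def max_def)
    ultimately show "admissible N (n1 N) (n2 N)"
      by (auto simp: admissible_def n1_def)
  next
    have "\<bar>real (n1 N) - t a1 N\<bar> \<le> 1" for N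
      using floor[OF t1(1)[of N]] t1(1)[of N] unfolding n1_def of_nat_max of_nat_1 by linarith
    then show "(\<lambda>N. tooth_pos N (n1 N)) \<longlonglongrightarrow> a1"
      by (intro tooth_pos_tendstoI) (simp add: t_def)
    have "\<bar>real (n2 N) - t a2 N\<bar> \<le> 1" for N
      using floor[OF t2_nonneg[of N]] t2[of N] half[of N] unfolding n2_def of_nat_max by linarith
    then show "(\<lambda>N. tooth_pos N (n2 N)) \<longlonglongrightarrow> a2"
      by (intro tooth_pos_tendstoI) (simp add: t_def)
  qed
qed

theorem theorem1p1:
  fixes M :: "nat \<Rightarrow> 'a measure" and \<xi> :: "nat \<Rightarrow> nat \<Rightarrow> 'a \<Rightarrow> real"
    and p :: "real \<times> real \<Rightarrow> real"
  assumes comb: "\<And>N. N \<ge> 2 \<Longrightarrow> random_comb N (M N) (\<xi> N)"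
  shows "limit_density M \<xi> p \<longleftrightarrow>
    (\<forall>a1\<in>{-1..0}. \<forall>a2\<in>{0..1}.
       p (a1, a2) = (a2 - a1) * (4 / (3 * (1 + a2) ^ 3) + 4 / (3 * (1 - a1) ^ 3) + 1 / 6))"
proof (intro iffI ballI)
  fix a1 a2 :: real assume dens: "limit_density M \<xi> p" and a: "a1 \<in> {-1..0}" "a2 \<in> {0..1}"
  obtain n1 n2 where n: "\<And>N. N \<ge> 2 \<Longrightarrow> admissible N (n1 N) (n2 N)"
    "(\<lambda>N. tooth_pos N (n1 N)) \<longlonglongrightarrow> a1" "(\<lambda>N. tooth_pos N (n2 N)) \<longlonglongrightarrow> a2"
    using admissible_sequences_exist[OF a] by blast
  have "(\<lambda>N. real N ^ 2 / 4 * support_prob N (M N) (\<xi> N) (n1 N) (n2 N)) \<longlonglongrightarrow> p (a1, a2)"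
    using dens a n unfolding limit_density_def by blast
  then show "p (a1, a2) = (a2 - a1) * (4 / (3 * (1 + a2) ^ 3) + 4 / (3 * (1 - a1) ^ 3) + 1 / 6)"
    using support_prob_tendsto[OF comb n a] by (rule LIMSEQ_unique)
next
  assume p: "\<forall>a1\<in>{-1..0}. \<forall>a2\<in>{0..1}.
       p (a1, a2) = (a2 - a1) * (4 / (3 * (1 + a2) ^ 3) + 4 / (3 * (1 - a1) ^ 3) + 1 / 6)"
  show "limit_density M \<xi> p"
    unfolding limit_density_def
  proof (intro ballI conjI allI impI)
    fix a1 a2 :: real assume a: "a1 \<in> {-1..0}" "a2 \<in> {0..1}"
    then show "0 \<le> p (a1, a2)" using p by simp
    fix n1 n2 :: "nat \<Rightarrow> nat"
    assume "\<forall>N\<ge>2. admissible N (n1 N) (n2 N)"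
      "(\<lambda>N. tooth_pos N (n1 N)) \<longlonglongrightarrow> a1" "(\<lambda>N. tooth_pos N (n2 N)) \<longlonglongrightarrow> a2"
    then show "(\<lambda>N. real N ^ 2 / 4 * support_prob N (M N) (\<xi> N) (n1 N) (n2 N)) \<longlonglongrightarrow> p (a1, a2)"
      using support_prob_tendsto[of M \<xi> n1 n2 a1 a2] comb a p by simp
  qed
qed

end
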